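(* Let $\mathcal{G}$ be a connected metric graph with vertex set $\mathsf{V}$ and strengths $\alpha\in\mathbb{R}^{\mathsf{V}}$. Then the torsion function of $(\mathcal{G},\alpha)$ exists as a strictly positive function if and only if the infimum of the spectrum of the weighted discrete Laplacian $L_{\mathcal{G},\alpha}$ on $\ell^2(\mathsf{V})$ is strictly positive, where $L_{\mathcal{G},\alpha}$ is the linear operator given by $$(L_{\mathcal{G},\alpha}g)(\mathsf{v})=\frac{2}{d^{\ell}_{\mathsf{v}}}\left(\sum_{\mathsf{e}=[\mathsf{v},\mathsf{w}]\in\mathsf{E}_{\mathsf{v}}}\frac{g(\mathsf{v})-g(\mathsf{w})}{\ell_{\mathsf{e}}}+\alpha_{\mathsf{v}}g(\mathsf{v})\right),\qquad d^{\ell}_{\mathsf{v}}=\sum_{\mathsf{e}\in\mathsf{E}_{\mathsf{v}}}\ell_{\mathsf{e}},\qquad \mathsf{v}\in\mathsf{V}.$$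
   Context: A metric graph $\mathcal{G}$ is a finite collection of intervals glued together at their endpoints according to a finite combinatorial graph $(\mathsf{V},\mathsf{E})$ (loops and multiple edges allowed); each edge $\mathsf{e}\in\mathsf{E}$ is identified with $[0,\ell_{\mathsf{e}}]$, $\ell_{\mathsf{e}}\in(0,\infty)$. It is connected if any two points are joined by a continuous path. $\mathsf{E}_{\mathsf{v}}$ is the collection of edges incident to $\mathsf{v}$ (a loop at $\mathsf{v}$ counted twice, once for each endpoint), $\mathsf{e}=[\mathsf{v},\mathsf{w}]$ means that $\mathsf{e}$ has endpoints $\mathsf{v},\mathsf{w}$, $u_{\mathsf{e}}$ is the restriction of $u$ to $\mathsf{e}$, and $\frac{\partial u_{\mathsf{e}}}{\partial n}(\mathsf{v})$ is the derivative of $u_{\mathsf{e}}$ at the endpoint $\mathsf{v}$ in the direction pointing into $\mathsf{v}$. For $\alpha\in\mathbb{R}^{\mathsf{V}}$, the operator $-\Delta_{\mathcal{G},\alpha}$ in $L^2(\mathcal{G})$ acts as $u\mapsto -u''$ on each edge, on functions that are edgewise in $H^2(0,\ell_{\mathsf{e}})$, continuous at every vertex, and satisfy $\sum_{\mathsf{e}\in\mathsf{E}_{\mathsf{v}}}\frac{\partial u_{\mathsf{e}}}{\partial n}(\mathsf{v})+\alpha_{\mathsf{v}}u(\mathsf{v})=0$ for all $\mathsf{v}\in\mathsf{V}$. The torsion function of $(\mathcal{G},\alpha)$ is the unique solution $\upsilon$ of $-\Delta_{\mathcal{G},\alpha}\upsilon=1$; it "exists" if this equation has a unique solution. *)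

theory Defs
  imports "HOL-Analysis.Analysis"
begin

(* The vertex set and the (nonempty) edge set are the types 'v and 'e, which are assumed finite
   wherever a metric graph is used.  The edge e is the interval {0..len G e}, with 0 glued to the
   vertex src G e and len G e glued to tgt G e.  The orientation is only a parametrisation; loops
   (src G e = tgt G e) and parallel edges are allowed. *)
record ('v, 'e) metric_graph =
  src :: "'e \<Rightarrow> 'v"
  tgt :: "'e \<Rightarrow> 'v"
  len :: "'e \<Rightarrow> real"

(* A pair (e, b) is an endpoint of the edge e: b = False is the end at 0, b = True the end
   at len G e.  A loop at v contributes two elements to incident G v. *)
definition endpt :: "('v, 'e) metric_graph \<Rightarrow> 'e \<Rightarrow> bool \<Rightarrow> 'v" where
  "endpt G e b = (if b then tgt G e else src G e)"

definition endpos :: "('v, 'e) metric_graph \<Rightarrow> 'e \<Rightarrow> bool \<Rightarrow> real" where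
  "endpos G e b = (if b then len G e else 0)"

definition incident :: "('v, 'e) metric_graph \<Rightarrow> 'v \<Rightarrow> ('e \<times> bool) set" where
  "incident G v = {(e, b). endpt G e b = v}"


section \<open>The metric graph as a topological space\<close>

(* A point of the metric graph is a vertex (Inl) or an interior point of an edge (Inr). *)
definition mg_points :: "('v, 'e) metric_graph \<Rightarrow> ('v + 'e \<times> real) set" where
  "mg_points G = range Inl \<union> {Inr (e, x) | e x. 0 < x \<and> x < len G e}"

definition mg_glue :: "('v, 'e) metric_graph \<Rightarrow> 'e \<times> real \<Rightarrow> 'v + 'e \<times> real" where
  "mg_glue G = (\<lambda>(e, x). if x = 0 then Inl (src G e)
                         else if x = len G e then Inl (tgt G e) else Inr (e, x))"

definition mg_intervals :: "('v, 'e) metric_graph \<Rightarrow> ('e \<times> real) topology" where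
  "mg_intervals G = sum_topology (\<lambda>e. top_of_set {0..len G e}) UNIV"

(* quotient topology with respect to mg_glue *)
definition mg_topology :: "('v, 'e) metric_graph \<Rightarrow> ('v + 'e \<times> real) topology" where
  "mg_topology G = topology (\<lambda>U. U \<subseteq> mg_points G \<and>
     openin (mg_intervals G) {p \<in> topspace (mg_intervals G). mg_glue G p \<in> U})"

lemma openin_mg_topology:
  "openin (mg_topology G) U \<longleftrightarrow> U \<subseteq> mg_points G \<and>
     openin (mg_intervals G) {p \<in> topspace (mg_intervals G). mg_glue G p \<in> U}"
proof -
  let ?X = "mg_intervals G"
  let ?P = "\<lambda>U. {p \<in> topspace ?X. mg_glue G p \<in> U}"
  have "?P (S \<inter> T) = ?P S \<inter> ?P T" "?P (\<Union>K) = \<Union>(?P ` K)" for S T K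
    by auto
  then have "istopology (\<lambda>U. U \<subseteq> mg_points G \<and> openin ?X (?P U))"
    unfolding istopology_def by (auto intro!: openin_Int openin_Union)
  then show ?thesis
    by (simp add: mg_topology_def)
qed

lemma topspace_mg_topology:
  assumes "\<And>e. 0 < len G e"
  shows "topspace (mg_topology G) = mg_points G"
proof -
  have "mg_glue G p \<in> mg_points G" if "p \<in> topspace (mg_intervals G)" for p
    using that by (auto simp: mg_points_def mg_glue_def mg_intervals_def)
  then have "{p \<in> topspace (mg_intervals G). mg_glue G p \<in> mg_points G} = topspace (mg_intervals G)"
    by auto
  then have "openin (mg_topology G) (mg_points G)"
    by (simp add: openin_mg_topology)
  then show ?thesis
    by (metis openin_mg_topology openin_subset openin_topspace subset_antisym)
qed


section \<open>The Laplacian on the metric graph\<close>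

definition edge_deriv :: "real \<Rightarrow> (real \<Rightarrow> complex) \<Rightarrow> real \<Rightarrow> complex" where
  "edge_deriv l u x = vector_derivative u (at x within {0..l})"

definition square_integrable :: "real \<Rightarrow> (real \<Rightarrow> complex) \<Rightarrow> bool" where
  "square_integrable l f \<longleftrightarrow> f \<in> borel_measurable (lebesgue_on {0..l}) \<and>
     integrable (lebesgue_on {0..l}) (\<lambda>x. (cmod (f x))\<^sup>2)"

(* The continuous representative u of an element of H^2(0,l) has second weak derivative w:
   u is differentiable on [0,l], and u' is absolutely continuous with density w in L^2(0,l).
   As u enters only through its values on [0,l] and w only through integrals, w is determined
   up to null sets, i.e. as an element of L^2(0,l). *)
definition has_second_deriv :: "real \<Rightarrow> (real \<Rightarrow> complex) \<Rightarrow> (real \<Rightarrow> complex) \<Rightarrow> bool" where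
  "has_second_deriv l u w \<longleftrightarrow>
     (\<forall>x\<in>{0..l}. u differentiable (at x within {0..l})) \<and>
     square_integrable l w \<and>
     (\<forall>x\<in>{0..l}. edge_deriv l u x = edge_deriv l u 0 + integral\<^sup>L (lebesgue_on {0..x}) w)"

definition sobolev_H2 :: "real \<Rightarrow> (real \<Rightarrow> complex) set" where
  "sobolev_H2 l = {u. \<exists>w. has_second_deriv l u w}"

(* derivative at an endpoint of e in the direction pointing into the vertex *)
definition normal_deriv ::
    "('v, 'e) metric_graph \<Rightarrow> ('e \<Rightarrow> real \<Rightarrow> complex) \<Rightarrow> 'e \<Rightarrow> bool \<Rightarrow> complex" where
  "normal_deriv G u e b =
     (if b then edge_deriv (len G e) (u e) (len G e) else - edge_deriv (len G e) (u e) 0)"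

(* Functions on the metric graph are given edgewise; only the values u e x with x in
   {0..len G e} matter.  U collects the vertex values of u. *)
definition laplacian_domain ::
    "('v, 'e) metric_graph \<Rightarrow> ('v \<Rightarrow> real) \<Rightarrow> ('e \<Rightarrow> real \<Rightarrow> complex) set" where
  "laplacian_domain G \<alpha> = {u. (\<forall>e. u e \<in> sobolev_H2 (len G e)) \<and>
     (\<exists>U. (\<forall>e b. u e (endpos G e b) = U (endpt G e b)) \<and>
          (\<forall>v. (\<Sum>(e, b)\<in>incident G v. normal_deriv G u e b) + of_real (\<alpha> v) * U v = 0))}"

(* - Delta_(G,alpha) u = f in L^2(G), that is, u lies in the domain and u'' = - f a.e. *)
definition laplacian_eq :: "('v, 'e) metric_graph \<Rightarrow> ('v \<Rightarrow> real) \<Rightarrow>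
    ('e \<Rightarrow> real \<Rightarrow> complex) \<Rightarrow> ('e \<Rightarrow> real \<Rightarrow> complex) \<Rightarrow> bool" where
  "laplacian_eq G \<alpha> u f \<longleftrightarrow> u \<in> laplacian_domain G \<alpha> \<and>
     (\<forall>e. has_second_deriv (len G e) (u e) (\<lambda>x. - f e x))"

definition is_torsion_function ::
    "('v, 'e) metric_graph \<Rightarrow> ('v \<Rightarrow> real) \<Rightarrow> ('e \<Rightarrow> real \<Rightarrow> complex) \<Rightarrow> bool" where
  "is_torsion_function G \<alpha> u \<longleftrightarrow> laplacian_eq G \<alpha> u (\<lambda>e x. 1) \<and>
     (\<forall>u'. laplacian_eq G \<alpha> u' (\<lambda>e x. 1) \<longrightarrow> (\<forall>e. \<forall>x\<in>{0..len G e}. u' e x = u e x))"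

definition strictly_positive :: "('v, 'e) metric_graph \<Rightarrow> ('e \<Rightarrow> real \<Rightarrow> complex) \<Rightarrow> bool" where
  "strictly_positive G u \<longleftrightarrow> (\<forall>e. \<forall>x\<in>{0..len G e}. u e x \<in> \<real> \<and> 0 < Re (u e x))"


section \<open>The weighted discrete Laplacian\<close>

definition weighted_degree :: "('v, 'e) metric_graph \<Rightarrow> 'v \<Rightarrow> real" where
  "weighted_degree G v = (\<Sum>(e, b)\<in>incident G v. len G e)"

(* The vertex opposite to the endpoint (e, b) is endpt G e (\<not> b). *)
definition discrete_laplacian ::
    "('v, 'e) metric_graph \<Rightarrow> ('v \<Rightarrow> real) \<Rightarrow> ('v \<Rightarrow> complex) \<Rightarrow> ('v \<Rightarrow> complex)" where
  "discrete_laplacian G \<alpha> g v = of_real (2 / weighted_degree G v) *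
     ((\<Sum>(e, b)\<in>incident G v. (g v - g (endpt G e (\<not> b))) / of_real (len G e))
      + of_real (\<alpha> v) * g v)"

(* Spectrum of a linear operator on l^2(V).  As 'v is finite, l^2(V) consists of all functions
   and every inverse is bounded. *)
definition op_spectrum :: "(('v::finite \<Rightarrow> complex) \<Rightarrow> ('v \<Rightarrow> complex)) \<Rightarrow> complex set" where
  "op_spectrum T = {z. \<not> bij (\<lambda>g v. T g v - z * g v)}"

end

(* On every edge a solution of u'' = -1 is the parabola determined by its two vertex values, and
   its normal derivative at an endpoint v is (U v - U w) / len - len / 2.  Hence the vertex
   conditions of the torsion problem say exactly that L U = 1 for the vertex values U, and the
   torsion function is positive iff U is.

   L is selfadjoint with respect to the vertex weights weighted_degree / 2, so the bottom mu of its
   spectrum is the minimum of a Rayleigh quotient.  If mu > 0, the form is positive definite, L U = 1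
   is uniquely solvable, and testing with the negative part of U shows U > 0.  Conversely, given
   U > 0 with L U = 1 and a ground state x, evaluating L x = mu x at a vertex where |x / U| is
   maximal gives mu * U >= 1 there. *)
theory Submission
  imports Defs
begin

section \<open>Solutions of u'' = -1 on a single edge\<close>

text \<open>Linear interpolation between the end values plus the torsion function of the interval
  with Dirichlet ends.\<close>

definition edge_parabola :: "real \<Rightarrow> complex \<Rightarrow> complex \<Rightarrow> real \<Rightarrow> complex" where
  "edge_parabola l p q x = p + of_real (x / l) * (q - p) + of_real (x * (l - x) / 2)"

lemma edge_parabola_ends [simp]:
  "edge_parabola l p q 0 = p" "0 < l \<Longrightarrow> edge_parabola l p q l = q"
  by (simp_all add: edge_parabola_def)

lemma has_vector_derivative_edge_parabola:
  assumes "0 < l"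
  shows "(edge_parabola l p q has_vector_derivative (q - p) / of_real l + of_real (l / 2 - x))
           (at x within S)"
proof -
  have eq: "edge_parabola l p q = (\<lambda>x. p + (x / l) *\<^sub>R (q - p) + (x * (l - x) / 2) *\<^sub>R 1)"
    by (simp add: edge_parabola_def fun_eq_iff scaleR_conv_of_real)
  show ?thesis
    unfolding eq using assms
    by (auto intro!: derivative_eq_intros simp: scaleR_conv_of_real field_simps)
qed

lemma edge_deriv_eqI:
  assumes "0 < l" "x \<in> {0..l}" "(u has_vector_derivative d) (at x within {0..l})"
  shows "edge_deriv l u x = d"
  using assms vector_derivative_within_cbox[of 0 l x u d] by (simp add: edge_deriv_def)

lemma has_vector_derivative_eq_edge_parabola:
  assumes "0 < l" "x \<in> {0..l}" "\<And>x. x \<in> {0..l} \<Longrightarrow> u x = edge_parabola l p q x"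
  shows "(u has_vector_derivative (q - p) / of_real l + of_real (l / 2 - x)) (at x within {0..l})"
  by (rule has_vector_derivative_transform[OF assms(2) _ has_vector_derivative_edge_parabola])
    (use assms in auto)

lemma edge_deriv_edge_parabola:
  assumes "0 < l" "x \<in> {0..l}" "\<And>x. x \<in> {0..l} \<Longrightarrow> u x = edge_parabola l p q x"
  shows "edge_deriv l u x = (q - p) / of_real l + of_real (l / 2 - x)"
  using edge_deriv_eqI[OF assms(1,2) has_vector_derivative_eq_edge_parabola[OF assms]] by simp

lemma integral_lebesgue_on_one:
  assumes "0 \<le> x"
  shows "integral\<^sup>L (lebesgue_on {0..x}) (\<lambda>_. 1 :: complex) = of_real x"
  using assms by (simp add: measure_restrict_space scaleR_conv_of_real)

lemma square_integrable_const: "square_integrable l (\<lambda>_. c)"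
  unfolding square_integrable_def
  by (auto intro!: finite_measure.integrable_const finite_measure_lebesgue_on)

text \<open>Integrating the density -1 gives u'(x) = u'(0) - x, so \<open>u\<close> and the parabola
  with the same value and slope at 0 differ by a constant, which vanishes at 0.\<close>

lemma has_second_deriv_minus_one_iff:
  assumes l: "0 < l"
  shows "has_second_deriv l u (\<lambda>_. - 1) \<longleftrightarrow>
    (\<forall>x\<in>{0..l}. u x = edge_parabola l (u 0) (u l) x)"
proof
  assume "\<forall>x\<in>{0..l}. u x = edge_parabola l (u 0) (u l) x"
  then have u: "u x = edge_parabola l (u 0) (u l) x" if "x \<in> {0..l}" for x
    using that by blast
  show "has_second_deriv l u (\<lambda>_. - 1)"
    unfolding has_second_deriv_def
  proof (intro conjI ballI)
    fix x assume x: "x \<in> {0..l}"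
    show "u differentiable at x within {0..l}"
      using has_vector_derivative_eq_edge_parabola[OF l x u] by (rule differentiableI_vector)
    show "edge_deriv l u x = edge_deriv l u 0 + integral\<^sup>L (lebesgue_on {0..x}) (\<lambda>_. - 1)"
      using edge_deriv_edge_parabola[OF l x u] edge_deriv_edge_parabola[OF l _ u, of 0] x l
      by (simp add: integral_lebesgue_on_one del: Bochner_Integration.lebesgue_integral_const)
  qed (rule square_integrable_const)
next
  assume h: "has_second_deriv l u (\<lambda>_. - 1)"
  define c where "c = edge_deriv l u 0"
  \<comment> \<open>Integrating u'(x) = c - x over the edge forces this value at \<open>l\<close>;
    with it the parabola has slope \<open>c\<close> at 0.\<close>
  define q where "q = u 0 + of_real l * (c - of_real (l / 2))"
  have du: "(u has_vector_derivative c - of_real x) (at x within {0..l})" if x: "x \<in> {0..l}" for x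
  proof -
    have "edge_deriv l u x = c + integral\<^sup>L (lebesgue_on {0..x}) (\<lambda>_. - 1)"
      using h x unfolding has_second_deriv_def c_def by blast
    then have "edge_deriv l u x = c - of_real x"
      using x by (simp add: integral_lebesgue_on_one del: Bochner_Integration.lebesgue_integral_const)
    moreover have "(u has_vector_derivative edge_deriv l u x) (at x within {0..l})"
      using h x unfolding has_second_deriv_def edge_deriv_def vector_derivative_works by blast
    ultimately show ?thesis by simp
  qed
  have d0: "((\<lambda>x. u x - edge_parabola l (u 0) q x) has_vector_derivative 0) (at x within {0..l})"
    if "x \<in> {0..l}" for x
    using has_vector_derivative_diff[OF du[OF that] has_vector_derivative_edge_parabola[OF l, of "u 0" q]] l
    by (simp add: q_def)
  obtain k where "\<And>x. x \<in> {0..l} \<Longrightarrow> u x - edge_parabola l (u 0) q x = k"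
    using has_vector_derivative_zero_constant[OF convex_real_interval(5) d0] by metis
  moreover from this[of 0] l have "k = 0" by simp
  ultimately have u: "u x = edge_parabola l (u 0) q x" if "x \<in> {0..l}" for x
    using that by (metis eq_iff_diff_eq_0)
  from u[of l] l have "u l = q" by simp
  with u show "\<forall>x\<in>{0..l}. u x = edge_parabola l (u 0) (u l) x" by blast
qed

section \<open>The vertex operator and its quadratic form\<close>

(* weighted_degree / 2 times the discrete Laplacian; unlike the latter it is symmetric for the
   unweighted inner product *)
definition vertex_op ::
    "('v, 'e) metric_graph \<Rightarrow> ('v \<Rightarrow> real) \<Rightarrow> ('v \<Rightarrow> 'a::real_vector) \<Rightarrow> 'v \<Rightarrow> 'a" where
  "vertex_op G \<alpha> g v =
     (\<Sum>(e, b)\<in>incident G v. (g v - g (endpt G e (\<not> b))) /\<^sub>R len G e) + \<alpha> v *\<^sub>R g v"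

lemma discrete_laplacian_eq:
  "discrete_laplacian G \<alpha> g v = (2 / weighted_degree G v) *\<^sub>R vertex_op G \<alpha> g v"
  by (simp add: discrete_laplacian_def vertex_op_def scaleR_conv_of_real field_simps split_beta)

text \<open>The operator has real coefficients, so it commutes with real-linear maps. Applied to
  \<open>Re\<close>, \<open>Im\<close> and \<open>complex_of_real\<close>, this passes between real
  and complex vertex functions.\<close>

lemma vertex_op_linear:
  assumes "linear f"
  shows "vertex_op G \<alpha> (\<lambda>v. f (g v)) v = f (vertex_op G \<alpha> g v)"
proof -
  interpret linear f by fact
  show ?thesis by (simp add: vertex_op_def add diff scaleR sum split_beta)
qed

lemma vertex_op_add: "vertex_op G \<alpha> (\<lambda>v. g v + h v) v = vertex_op G \<alpha> g v + vertex_op G \<alpha> h v"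
  by (simp add: vertex_op_def algebra_simps sum.distrib sum_subtractf split_beta)

lemma vertex_op_diff: "vertex_op G \<alpha> (\<lambda>v. g v - h v) v = vertex_op G \<alpha> g v - vertex_op G \<alpha> h v"
  by (simp add: vertex_op_def algebra_simps sum.distrib sum_subtractf split_beta)

lemma vertex_op_scaleR: "vertex_op G \<alpha> (\<lambda>v. c *\<^sub>R g v) v = c *\<^sub>R vertex_op G \<alpha> g v"
  by (rule vertex_op_linear) (rule linear_scaleR)

text \<open>Each endpoint (e, b) is incident to exactly one vertex, so the sets
  \<open>incident G v\<close> partition all endpoints; a loop has both its ends in the same
  set.\<close>

lemma sum_incident:
  fixes G :: "('v::finite, 'e::finite) metric_graph"
  shows "(\<Sum>v\<in>UNIV. \<Sum>(e, b)\<in>incident G v. F v e b) = (\<Sum>e\<in>UNIV. \<Sum>b\<in>UNIV. F (endpt G e b) e b)"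
proof -
  have "(\<Sum>v\<in>UNIV. \<Sum>(e, b)\<in>incident G v. F v e b)
      = (\<Sum>v\<in>UNIV. \<Sum>p\<in>{p. p \<in> UNIV \<and> endpt G (fst p) (snd p) = v}. F (endpt G (fst p) (snd p)) (fst p) (snd p))"
    by (intro sum.cong refl) (auto simp: incident_def)
  also have "\<dots> = (\<Sum>p\<in>UNIV. F (endpt G (fst p) (snd p)) (fst p) (snd p))"
    by (rule sum.group) auto
  also have "\<dots> = (\<Sum>e\<in>UNIV. \<Sum>b\<in>UNIV. F (endpt G e b) e b)"
    by (simp add: sum.cartesian_product split_beta flip: UNIV_Times_UNIV)
  finally show ?thesis .
qed

text \<open>Summation by parts: the two ends of an edge contribute the same difference of
  \<open>x\<close> with opposite signs, which combine into a product of differences. Loops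
  contribute 0 on both sides.\<close>

lemma vertex_op_form:
  fixes G :: "('v::finite, 'e::finite) metric_graph" and x y :: "'v \<Rightarrow> real"
  shows "(\<Sum>v\<in>UNIV. y v * vertex_op G \<alpha> x v) =
    (\<Sum>e\<in>UNIV. (y (src G e) - y (tgt G e)) * (x (src G e) - x (tgt G e)) / len G e)
      + (\<Sum>v\<in>UNIV. \<alpha> v * x v * y v)"
proof -
  have "(\<Sum>v\<in>UNIV. y v * vertex_op G \<alpha> x v) =
      (\<Sum>v\<in>UNIV. \<Sum>(e, b)\<in>incident G v. y v * ((x v - x (endpt G e (\<not> b))) / len G e))
      + (\<Sum>v\<in>UNIV. \<alpha> v * x v * y v)"
    by (simp add: vertex_op_def distrib_left sum.distrib sum_distrib_left split_beta field_simps)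
  also have "(\<Sum>v\<in>UNIV. \<Sum>(e, b)\<in>incident G v. y v * ((x v - x (endpt G e (\<not> b))) / len G e)) =
      (\<Sum>e\<in>UNIV. (y (src G e) - y (tgt G e)) * (x (src G e) - x (tgt G e)) / len G e)"
    unfolding sum_incident
    by (intro sum.cong refl) (simp add: UNIV_bool endpt_def add_divide_distrib[symmetric], simp add: algebra_simps)
  finally show ?thesis .
qed

lemma vertex_op_sym:
  fixes G :: "('v::finite, 'e::finite) metric_graph" and x y :: "'v \<Rightarrow> real"
  shows "(\<Sum>v\<in>UNIV. y v * vertex_op G \<alpha> x v) = (\<Sum>v\<in>UNIV. x v * vertex_op G \<alpha> y v)"
  by (simp add: vertex_op_form mult_ac)

section \<open>Reduction of the torsion problem to the vertices\<close>

lemma laplacian_eq_one_iff: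
  fixes G :: "('v::finite, 'e::finite) metric_graph"
  assumes l: "\<And>e. 0 < len G e"
  shows "laplacian_eq G \<alpha> u (\<lambda>e x. 1) \<longleftrightarrow>
    (\<exists>U. (\<forall>e. \<forall>x\<in>{0..len G e}. u e x = edge_parabola (len G e) (U (src G e)) (U (tgt G e)) x) \<and>
         (\<forall>v. vertex_op G \<alpha> U v = of_real (weighted_degree G v / 2)))"
proof -
  have vert: "(\<Sum>(e, b)\<in>incident G v. normal_deriv G u e b) + of_real (\<alpha> v) * U v = 0 \<longleftrightarrow>
      vertex_op G \<alpha> U v = of_real (weighted_degree G v / 2)"
    if u: "\<And>e x. x \<in> {0..len G e} \<Longrightarrow> u e x = edge_parabola (len G e) (U (src G e)) (U (tgt G e)) x" for U v
  proof -
    \<comment> \<open>The sign change of \<open>normal_deriv\<close> at 0 makes both ends of an edge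
      obey one formula. The terms \<open>len G e / 2\<close> then add up to half the weighted
      degree.\<close>
    have "normal_deriv G u e b = (U (endpt G e b) - U (endpt G e (\<not> b))) /\<^sub>R len G e - of_real (len G e / 2)" for e b
      using l[of e] edge_deriv_edge_parabola[OF l[of e] _ u, of 0] edge_deriv_edge_parabola[OF l[of e] _ u, of "len G e"]
      by (simp add: normal_deriv_def endpt_def scaleR_conv_of_real field_simps)
    then have "(\<Sum>(e, b)\<in>incident G v. normal_deriv G u e b) =
       (\<Sum>(e, b)\<in>incident G v. (U v - U (endpt G e (\<not> b))) /\<^sub>R len G e - of_real (len G e / 2))"
      by (intro sum.cong) (auto simp: incident_def)
    also have "\<dots> = (\<Sum>(e, b)\<in>incident G v. (U v - U (endpt G e (\<not> b))) /\<^sub>R len G e)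
        - of_real (weighted_degree G v / 2)"
      by (simp add: weighted_degree_def split_beta sum_subtractf sum_divide_distrib)
    finally have eq: "(\<Sum>(e, b)\<in>incident G v. normal_deriv G u e b) =
        (\<Sum>(e, b)\<in>incident G v. (U v - U (endpt G e (\<not> b))) /\<^sub>R len G e) - of_real (weighted_degree G v / 2)" .
    have "a - c + x = 0 \<longleftrightarrow> a + x = c" for a c x :: complex
      by (auto simp: algebra_simps)
    then show ?thesis
      unfolding eq vertex_op_def scaleR_conv_of_real[of "\<alpha> v"] .
  qed
  show ?thesis
  proof
    assume eq: "laplacian_eq G \<alpha> u (\<lambda>e x. 1)"
    then obtain U where U: "\<And>e b. u e (endpos G e b) = U (endpt G e b)"
      and k: "\<And>v. (\<Sum>(e, b)\<in>incident G v. normal_deriv G u e b) + of_real (\<alpha> v) * U v = 0"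
      by (auto simp: laplacian_eq_def laplacian_domain_def)
    have "u e 0 = U (src G e)" "u e (len G e) = U (tgt G e)" for e
      using U[of e False] U[of e True] by (simp_all add: endpos_def endpt_def)
    then have u: "u e x = edge_parabola (len G e) (U (src G e)) (U (tgt G e)) x" if "x \<in> {0..len G e}" for e x
      using eq has_second_deriv_minus_one_iff[OF l, of e "u e"] that by (simp add: laplacian_eq_def)
    then show "\<exists>U. (\<forall>e. \<forall>x\<in>{0..len G e}. u e x = edge_parabola (len G e) (U (src G e)) (U (tgt G e)) x) \<and>
         (\<forall>v. vertex_op G \<alpha> U v = of_real (weighted_degree G v / 2))"
      using vert[OF u] k by blast
  next
    assume "\<exists>U. (\<forall>e. \<forall>x\<in>{0..len G e}. u e x = edge_parabola (len G e) (U (src G e)) (U (tgt G e)) x) \<and>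
         (\<forall>v. vertex_op G \<alpha> U v = of_real (weighted_degree G v / 2))"
    then obtain U where u: "\<And>e x. x \<in> {0..len G e} \<Longrightarrow> u e x = edge_parabola (len G e) (U (src G e)) (U (tgt G e)) x"
      and k: "\<And>v. vertex_op G \<alpha> U v = of_real (weighted_degree G v / 2)"
      by blast
    have e: "u e 0 = U (src G e)" "u e (len G e) = U (tgt G e)" for e
      using l[of e] by (simp_all add: u)
    then have h: "has_second_deriv (len G e) (u e) (\<lambda>x. - 1)" for e
      using has_second_deriv_minus_one_iff[OF l, of e "u e"] u[of _ e] by simp
    moreover have "u e (endpos G e b) = U (endpt G e b)" for e b
      using e by (simp add: endpos_def endpt_def)
    ultimately show "laplacian_eq G \<alpha> u (\<lambda>e x. 1)"
      using k vert[OF u] unfolding laplacian_eq_def laplacian_domain_def sobolev_H2_def by blast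
  qed
qed

text \<open>A vertex without incident edges is never hit by \<open>mg_glue\<close>, so both its
  singleton and the complement are open, against connectedness.\<close>

lemma weighted_degree_pos:
  fixes G :: "('v::finite, 'e::finite) metric_graph"
  assumes l: "\<And>e. 0 < len G e" and conn: "path_connected_space (mg_topology G)"
  shows "0 < weighted_degree G v"
proof -
  have "incident G v \<noteq> {}"
  proof
    assume "incident G v = {}"
    then have "(e, b) \<notin> incident G v" for e b
      by simp
    from this[of _ False] this[of _ True] have ne: "src G e \<noteq> v" "tgt G e \<noteq> v" for e
      by (simp_all add: incident_def endpt_def)
    let ?T = "topspace (mg_intervals G)"
    have "{p \<in> ?T. mg_glue G p \<in> {Inl v}} = {}"
      using ne by (auto simp: mg_glue_def split: if_splits)
    then have 1: "openin (mg_topology G) {Inl v}"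
      unfolding openin_mg_topology by (simp only:) (simp add: mg_points_def)
    have "{p \<in> ?T. mg_glue G p \<in> mg_points G - {Inl v}} = ?T"
      using ne by (auto simp: mg_glue_def mg_points_def mg_intervals_def split: if_splits)
    then have 2: "openin (mg_topology G) (mg_points G - {Inl v})"
      unfolding openin_mg_topology by (simp only:) auto
    \<comment> \<open>The type of edges is inhabited, so \<open>undefined\<close> names some edge;
      its midpoint shows that the complement is nonempty.\<close>
    have "Inr (undefined, len G undefined / 2) \<in> mg_points G - {Inl v}"
      using l[of undefined] by (auto simp: mg_points_def intro!: exI[of _ "len G undefined / 2"])
    moreover have "connected_space (mg_topology G)"
      using conn by (rule path_connected_imp_connected_space)
    ultimately show False
      using 1 2 topspace_mg_topology[of G, OF l] unfolding connected_space_def by blast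
  qed
  then show ?thesis
    unfolding weighted_degree_def using l by (intro sum_pos) auto
qed

section \<open>Linear algebra on functions of the vertices\<close>

text \<open>The operator is transported to the Euclidean space \<open>'a ^ 'v\<close>, where
  injective linear endomorphisms are surjective. Only real linearity is asked, so real and complex
  vertex functions are both covered.\<close>

lemma inj_imp_surj_fun:
  fixes T :: "('v::finite \<Rightarrow> 'a::euclidean_space) \<Rightarrow> 'v \<Rightarrow> 'a"
  assumes add: "\<And>g h v. T (\<lambda>v. g v + h v) v = T g v + T h v"
    and scale: "\<And>c g v. T (\<lambda>v. c *\<^sub>R g v) v = c *\<^sub>R T g v"
    and "inj T"
  shows "surj T"
proof -
  define F :: "'a ^ 'v \<Rightarrow> 'a ^ 'v" where "F x = vec_lambda (T (vec_nth x))" for x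
  have "linear F"
    by (rule linearI) (simp_all add: F_def vec_eq_iff plus_vec_def scaleR_vec_def vec_lambda_inverse add scale)
  moreover have "inj F"
  proof (rule injI)
    fix x y assume "F x = F y"
    then have "T (vec_nth x) = T (vec_nth y)" by (simp add: F_def vec_lambda_inject)
    then have "vec_nth x = vec_nth y" by (rule injD[OF \<open>inj T\<close>])
    then show "x = y" by (simp add: vec_nth_inject)
  qed
  ultimately have "surj F"
    by (rule linear_injective_imp_surjective) simp
  show ?thesis
  proof (rule surjI)
    fix y
    show "T (vec_nth (inv F (vec_lambda y))) = y"
      using surj_f_inv_f[OF \<open>surj F\<close>, of "vec_lambda y"] by (simp add: F_def vec_lambda_inject)
  qed
qed

text \<open>In finite dimension a failure of bijectivity is a failure of injectivity, and the
  difference of two functions with the same image is an eigenvector.\<close>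

lemma op_spectrum_eigenvector:
  fixes T :: "('v::finite \<Rightarrow> complex) \<Rightarrow> 'v \<Rightarrow> complex"
  assumes add: "\<And>g h v. T (\<lambda>v. g v + h v) v = T g v + T h v"
    and scale: "\<And>c g v. T (\<lambda>v. c *\<^sub>R g v) v = c *\<^sub>R T g v"
    and "z \<in> op_spectrum T"
  obtains g where "g \<noteq> (\<lambda>_. 0)" "\<And>v. T g v = z * g v"
proof -
  let ?S = "\<lambda>g v. T g v - z * g v"
  have "\<not> inj ?S"
  proof
    assume "inj ?S"
    moreover have "surj ?S"
      by (rule inj_imp_surj_fun) (use \<open>inj ?S\<close> in \<open>simp_all add: add scale algebra_simps\<close>)
    ultimately show False
      using assms(3) by (simp add: op_spectrum_def bij_def)
  qed
  then obtain g h where "g \<noteq> h" and eq: "?S g = ?S h"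
    by (auto simp: inj_def)
  have diff: "T (\<lambda>v. g v - h v) v = T g v - T h v" for v
    using add[of g "\<lambda>v. (-1) *\<^sub>R h v" v] scale[of "-1" h v] by simp
  show ?thesis
  proof
    show "(\<lambda>v. g v - h v) \<noteq> (\<lambda>_. 0)"
      using \<open>g \<noteq> h\<close> by (auto simp: fun_eq_iff)
    show "T (\<lambda>v. g v - h v) v = z * (g v - h v)" for v
      using fun_cong[OF eq, of v] by (simp add: diff algebra_simps)
  qed
qed

section \<open>The ground state as minimiser of the Rayleigh quotient\<close>

text \<open>For small t the linear term dominates and would take both signs. This is the first-order
  condition at a minimum.\<close>

lemma linear_coeff_eq_0:
  fixes b c :: real
  assumes "\<And>t. 0 \<le> 2 * t * b + t\<^sup>2 * c" "0 \<le> c"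
  shows "b = 0"
proof (rule ccontr)
  assume "b \<noteq> 0"
  \<comment> \<open>Nearly the minimiser - b / c, but defined also for c = 0; the value there is -
    t^2 (c + 2).\<close>
  define t where "t = - b / (c + 1)"
  have b: "b = - t * (c + 1)" and "t \<noteq> 0"
    using \<open>b \<noteq> 0\<close> \<open>0 \<le> c\<close> by (auto simp: t_def)
  have "2 * t * b + t\<^sup>2 * c = - (t\<^sup>2 * (c + 2))"
    unfolding b by (simp add: power2_eq_square algebra_simps)
  moreover have "0 < t\<^sup>2 * (c + 2)"
    using \<open>t \<noteq> 0\<close> \<open>0 \<le> c\<close> by simp
  ultimately show False
    using assms(1)[of t] by simp
qed

text \<open>The quotient \<open>Q / N\<close> attains its minimum \<open>\<mu>\<close> on the
  compact Euclidean unit sphere. The form \<open>Q - \<mu> N\<close> is then nonnegative and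
  vanishes at the minimiser, which therefore lies in its kernel.\<close>

lemma ground_state:
  fixes G :: "('v::finite, 'e::finite) metric_graph" and m :: "'v \<Rightarrow> real"
  assumes m: "\<And>v. 0 < m v"
  obtains \<mu> x0 where "x0 \<noteq> (\<lambda>_. 0)" "\<And>v. vertex_op G \<alpha> x0 v = \<mu> * m v * x0 v"
    "\<And>x :: 'v \<Rightarrow> real. \<mu> * (\<Sum>v\<in>UNIV. m v * (x v)\<^sup>2) \<le> (\<Sum>v\<in>UNIV. x v * vertex_op G \<alpha> x v)"
proof -
  define Q where "Q x = (\<Sum>v\<in>UNIV. x v * vertex_op G \<alpha> x v)" for x :: "'v \<Rightarrow> real"
  define N where "N x = (\<Sum>v\<in>UNIV. m v * (x v)\<^sup>2)" for x :: "'v \<Rightarrow> real"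
  have N0: "0 < N x" if x: "x \<noteq> (\<lambda>_. 0)" for x
  proof -
    obtain v where "x v \<noteq> 0" using x by auto
    then show ?thesis
      unfolding N_def using m by (intro sum_pos2[where i=v]) (auto simp: less_imp_le)
  qed
  have "continuous_on (sphere 0 1) (\<lambda>x::real^'v. Q (vec_nth x) / N (vec_nth x))"
  proof (intro continuous_on_divide ballI)
    show "continuous_on (sphere 0 1) (\<lambda>x::real^'v. Q (vec_nth x))"
      unfolding Q_def vertex_op_def split_beta by (intro continuous_intros)
    show "continuous_on (sphere 0 1) (\<lambda>x::real^'v. N (vec_nth x))"
      unfolding N_def by (intro continuous_intros)
    fix x :: "real^'v" assume "x \<in> sphere 0 1"
    then have "x \<noteq> 0" by auto
    then have "vec_nth x \<noteq> (\<lambda>_. 0)" by (auto simp: vec_eq_iff)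
    then show "N (vec_nth x) \<noteq> 0" using N0 by force
  qed
  then obtain X :: "real^'v" where X: "X \<in> sphere 0 1"
    and min: "\<And>x::real^'v. x \<in> sphere 0 1 \<Longrightarrow> Q (vec_nth X) / N (vec_nth X) \<le> Q (vec_nth x) / N (vec_nth x)"
    using continuous_attains_inf[of "sphere 0 1 :: (real^'v) set" "\<lambda>x. Q (vec_nth x) / N (vec_nth x)"] by auto
  define x0 where "x0 = vec_nth X"
  define \<mu> where "\<mu> = Q x0 / N x0"
  have x0: "x0 \<noteq> (\<lambda>_. 0)"
  proof
    assume "x0 = (\<lambda>_. 0)"
    then have "X = 0" by (simp add: x0_def vec_eq_iff)
    then show False using X by simp
  qed
  define B where "B x y = (\<Sum>v\<in>UNIV. y v * (vertex_op G \<alpha> x v - \<mu> * m v * x v))" for x y :: "'v \<Rightarrow> real"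
  have BQ: "B x x = Q x - \<mu> * N x" for x
    by (simp add: B_def Q_def N_def sum_subtractf sum_distrib_left algebra_simps power2_eq_square)
  have nonneg: "0 \<le> B x x" for x
  proof (cases "x = (\<lambda>_. 0)")
    case False
    define c where "c = norm (vec_lambda x :: real^'v)"
    have c: "0 < c" using False unfolding c_def by (auto simp: vec_eq_iff)
    \<comment> \<open>\<open>Q\<close> and \<open>N\<close> are both homogeneous of degree 2, so
      minimality on the sphere extends to every nonzero \<open>x\<close>.\<close>
    define y where "y = (\<lambda>v. x v / c)"
    have "vec_lambda y = (1 / c) *\<^sub>R (vec_lambda x :: real^'v)"
      by (simp add: vec_eq_iff y_def)
    then have "norm (vec_lambda y :: real^'v) = 1"
      using c by (simp add: c_def)
    then have "\<mu> \<le> Q y / N y"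
      using min[of "vec_lambda y"] by (simp add: \<mu>_def x0_def vec_lambda_inverse)
    moreover have "N y = N x / c\<^sup>2"
      by (simp add: N_def y_def sum_divide_distrib power_divide)
    moreover have "y = (\<lambda>v. (1 / c) *\<^sub>R x v)"
      by (simp add: y_def)
    then have "Q y = Q x / c\<^sup>2"
      unfolding Q_def by (simp only: vertex_op_scaleR) (simp add: sum_divide_distrib power2_eq_square)
    ultimately have "\<mu> \<le> Q x / N x" using c by simp
    then show ?thesis using N0[OF False] by (simp add: BQ field_simps)
  qed (simp add: B_def)
  have sym: "B x y = B y x" for x y
    using vertex_op_sym[of y G \<alpha> x] by (simp add: B_def right_diff_distrib sum_subtractf mult_ac)
  have exp: "B (\<lambda>v. x v + t *\<^sub>R y v) (\<lambda>v. x v + t *\<^sub>R y v) = B x x + 2 * t * B x y + t\<^sup>2 * B y y" for x y t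
  proof -
    have "B (\<lambda>v. x v + t *\<^sub>R y v) (\<lambda>v. x v + t *\<^sub>R y v) = B x x + t * B y x + t * B x y + t\<^sup>2 * B y y"
      unfolding B_def vertex_op_add vertex_op_scaleR
      by (simp add: sum_distrib_left power2_eq_square algebra_simps sum.distrib sum_subtractf)
    then show ?thesis using sym[of x y] by simp
  qed
  have B0: "B x0 x0 = 0"
    using N0[OF x0] by (simp add: BQ \<mu>_def)
  have "B x0 y = 0" for y
  proof (rule linear_coeff_eq_0)
    show "0 \<le> 2 * t * B x0 y + t\<^sup>2 * B y y" for t
      using nonneg[of "\<lambda>v. x0 v + t *\<^sub>R y v"] unfolding exp B0 by simp
  qed (rule nonneg)
  \<comment> \<open>Testing with the residual itself makes the sum of its squares vanish.\<close>
  from this[of "\<lambda>v. vertex_op G \<alpha> x0 v - \<mu> * m v * x0 v"]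
  have "vertex_op G \<alpha> x0 v = \<mu> * m v * x0 v" for v
    by (simp add: B_def sum_nonneg_eq_0_iff)
  moreover have "\<mu> * (\<Sum>v\<in>UNIV. m v * (x v)\<^sup>2) \<le> (\<Sum>v\<in>UNIV. x v * vertex_op G \<alpha> x v)" for x
    using nonneg[of x] BQ[of x] by (simp add: Q_def N_def)
  ultimately show ?thesis using x0 that by blast
qed

section \<open>Positive solutions and positivity of the form\<close>

text \<open>The substitution \<open>x = h * U\<close> compares the two equations at a maximum of
  h^2. Squares are used because \<open>x\<close> may change sign.\<close>

lemma eigenvalue_pos:
  fixes G :: "('v::finite, 'e::finite) metric_graph" and x U m :: "'v \<Rightarrow> real"
  assumes l: "\<And>e. 0 < len G e"
    and m: "\<And>v. 0 < m v" and U: "\<And>v. 0 < U v" "\<And>v. vertex_op G \<alpha> U v = m v"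
    and x: "x \<noteq> (\<lambda>_. 0)" "\<And>v. vertex_op G \<alpha> x v = \<mu> * m v * x v"
  shows "0 < \<mu>"
proof -
  define h where "h v = x v / U v" for v
  have xh: "x v = h v * U v" for v
    using U(1)[of v] by (simp add: h_def)
  obtain v where v: "\<And>w. (h w)\<^sup>2 \<le> (h v)\<^sup>2"
  proof -
    have "Max (range (\<lambda>w. (h w)\<^sup>2)) \<in> range (\<lambda>w. (h w)\<^sup>2)" by (rule Max_in) auto
    then obtain v where "Max (range (\<lambda>w. (h w)\<^sup>2)) = (h v)\<^sup>2" by (rule rangeE)
    then show ?thesis using that[of v] by (metis Max_ge finite finite_imageI rangeI)
  qed
  obtain w where "h w \<noteq> 0" using x(1) xh by fastforce
  then have hv: "0 < (h v)\<^sup>2" using v[of w] by (metis less_le_trans zero_less_power2)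
  \<comment> \<open>From 2 h(v) h(w) \<le> h(v)^2 + h(w)^2 and the maximality of h(v)^2.\<close>
  have hw: "h v * h w \<le> (h v)\<^sup>2" for w
    using v[of w] sum_squares_ge_zero[of "h v - h w" 0] by (simp add: power2_eq_square algebra_simps)
  have "h v * vertex_op G \<alpha> x v =
      (\<Sum>(e, b)\<in>incident G v. h v * ((h v * U v - h (endpt G e (\<not> b)) * U (endpt G e (\<not> b))) / len G e))
      + (h v)\<^sup>2 * (\<alpha> v * U v)"
    by (simp add: vertex_op_def xh distrib_left sum_distrib_left split_beta power2_eq_square divide_inverse mult_ac)
  \<comment> \<open>Each edge term splits into h(v)^2 times the difference of \<open>U\<close> and a
    remainder that is nonnegative at the maximum by \<open>hw\<close>; the first parts reassemble
    \<open>vertex_op\<close> of \<open>U\<close>.\<close>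
  also have "(\<Sum>(e, b)\<in>incident G v. h v * ((h v * U v - h (endpt G e (\<not> b)) * U (endpt G e (\<not> b))) / len G e)) =
      (\<Sum>(e, b)\<in>incident G v. (h v)\<^sup>2 * ((U v - U (endpt G e (\<not> b))) / len G e)
        + ((h v)\<^sup>2 - h v * h (endpt G e (\<not> b))) * U (endpt G e (\<not> b)) / len G e)"
    by (intro sum.cong refl) (auto simp: power2_eq_square divide_inverse algebra_simps)
  finally have "h v * vertex_op G \<alpha> x v = (h v)\<^sup>2 * vertex_op G \<alpha> U v +
     (\<Sum>(e, b)\<in>incident G v. ((h v)\<^sup>2 - h v * h (endpt G e (\<not> b))) * U (endpt G e (\<not> b)) / len G e)"
    by (simp add: vertex_op_def distrib_left sum.distrib sum_distrib_left split_beta divide_inverse mult_ac)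
  moreover have "0 \<le> (\<Sum>(e, b)\<in>incident G v. ((h v)\<^sup>2 - h v * h (endpt G e (\<not> b))) * U (endpt G e (\<not> b)) / len G e)"
    using hw U(1) l by (intro sum_nonneg) (auto simp: less_imp_le)
  ultimately have "(h v)\<^sup>2 * m v \<le> h v * (\<mu> * m v * x v)"
    using x(2) U(2) by simp
  also have "\<dots> = (h v)\<^sup>2 * m v * (\<mu> * U v)"
    by (simp add: xh power2_eq_square)
  finally have "1 \<le> \<mu> * U v"
    using hv m[of v] by (simp add: mult_le_cancel_left1)
  then show ?thesis
    using U(1)[of v] by (smt (verit) mult_nonpos_nonneg)
qed

text \<open>The form at the negative part \<open>n\<close> of \<open>U\<close> is at most minus the
  pairing of \<open>n\<close> with \<open>m\<close>, so positive definiteness forces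
  \<open>n\<close> to vanish. A zero of \<open>U\<close> is excluded separately.\<close>

lemma minimum_principle:
  fixes G :: "('v::finite, 'e::finite) metric_graph" and U m :: "'v \<Rightarrow> real"
  assumes l: "\<And>e. 0 < len G e"
    and pos: "\<And>x :: 'v \<Rightarrow> real. x \<noteq> (\<lambda>_. 0) \<Longrightarrow> 0 < (\<Sum>v\<in>UNIV. x v * vertex_op G \<alpha> x v)"
    and m: "\<And>v. 0 < m v" and U: "\<And>v. vertex_op G \<alpha> U v = m v"
  shows "0 < U v"
proof -
  define n where "n v = max 0 (- U v)" for v
  have "(\<Sum>v\<in>UNIV. n v * vertex_op G \<alpha> n v) \<le> - (\<Sum>v\<in>UNIV. n v * vertex_op G \<alpha> U v)"
  proof -
    have "(n a - n b) * (n a - n b) / len G e \<le> - ((n a - n b) * (U a - U b) / len G e)" for a b e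
    proof -
      define p where "p v = max 0 (U v)" for v
      have U': "U v = p v - n v" and np: "n v * p v = 0" "0 \<le> n v" "0 \<le> p v" for v
        by (auto simp: n_def p_def max_def)
      \<comment> \<open>With \<open>U = p - n\<close> and \<open>n * p = 0\<close> at each vertex,
        only the nonnegative cross terms survive.\<close>
      have "- ((n a - n b) * (U a - U b)) - (n a - n b) * (n a - n b) =
          n a * p b + n b * p a"
        unfolding U' using np(1)[of a] np(1)[of b] by algebra
      also have "\<dots> \<ge> 0" using np(2,3) by simp
      finally have "(n a - n b) * (n a - n b) \<le> - ((n a - n b) * (U a - U b))" by simp
      then have "(n a - n b) * (n a - n b) / len G e \<le> - ((n a - n b) * (U a - U b)) / len G e"
        by (rule divide_right_mono) (simp add: l less_imp_le)
      then show ?thesis by (simp only: minus_divide_left)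
    qed
    \<comment> \<open>The potential terms agree exactly, so the sign of \<alpha> does not
      matter.\<close>
    moreover have "\<alpha> v * n v * n v = - (\<alpha> v * U v * n v)" for v
      by (simp add: n_def max_def)
    ultimately show ?thesis
      unfolding vertex_op_form by (simp add: sum_mono flip: sum_negf)
  qed
  also have "\<dots> \<le> 0"
    using m by (simp add: U n_def sum_nonneg less_imp_le)
  finally have "n = (\<lambda>_. 0)"
    using pos[of n] by fastforce
  then have nonneg: "0 \<le> U v" for v
    unfolding n_def fun_eq_iff by (auto simp: max_def dest!: spec[of _ v] split: if_splits)
  show ?thesis
  proof (rule ccontr)
    assume "\<not> 0 < U v"
    with nonneg[of v] have "U v = 0" by simp
    \<comment> \<open>At a zero of \<open>U\<close> the potential term vanishes and every difference
      to a neighbour is at most 0.\<close>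
    then have "vertex_op G \<alpha> U v \<le> 0"
      using nonneg l unfolding vertex_op_def
      by (auto intro!: sum_nonpos simp: less_imp_le)
    then show False using U m[of v] by simp
  qed
qed

section \<open>The bottom of the spectrum\<close>

text \<open>The eigenvector \<open>x0\<close>, read as a complex function, puts \<open>\<mu>\<close>
  into the spectrum. For the lower bound, the Rayleigh inequality is applied to the real and
  imaginary parts of an arbitrary complex eigenvector.\<close>

lemma Inf_op_spectrum:
  fixes G :: "('v::finite, 'e::finite) metric_graph"
  assumes d: "\<And>v. 0 < weighted_degree G v"
    and x0: "x0 \<noteq> (\<lambda>_. 0)" "\<And>v. vertex_op G \<alpha> x0 v = \<mu> * (weighted_degree G v / 2) * x0 v"
    and min: "\<And>x :: 'v \<Rightarrow> real. \<mu> * (\<Sum>v\<in>UNIV. weighted_degree G v / 2 * (x v)\<^sup>2)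
                \<le> (\<Sum>v\<in>UNIV. x v * vertex_op G \<alpha> x v)"
  shows "Inf (Re ` op_spectrum (discrete_laplacian G \<alpha>)) = \<mu>"
proof (rule cInf_eq_minimum)
  let ?T = "discrete_laplacian G \<alpha>"
  have zero: "?T (\<lambda>_. 0) = (\<lambda>_. 0)"
    by (simp add: fun_eq_iff discrete_laplacian_eq vertex_op_def)
  have ev: "?T (\<lambda>v. of_real (x0 v)) v = of_real \<mu> * of_real (x0 v)" for v
  proof -
    have "vertex_op G \<alpha> (\<lambda>v. complex_of_real (x0 v)) v = of_real (\<mu> * (weighted_degree G v / 2) * x0 v)"
      using vertex_op_linear[of complex_of_real G \<alpha> x0 v] x0(2) bounded_linear_of_real
      by (simp add: bounded_linear.linear)
    then have "?T (\<lambda>v. of_real (x0 v)) v =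
        of_real (2 / weighted_degree G v * (\<mu> * (weighted_degree G v / 2) * x0 v))"
      by (simp only: discrete_laplacian_eq scaleR_conv_of_real of_real_mult)
    also have "2 / weighted_degree G v * (\<mu> * (weighted_degree G v / 2) * x0 v) = \<mu> * x0 v"
      using d[of v] by simp
    finally show ?thesis by simp
  qed
  have "\<not> inj (\<lambda>g v. ?T g v - of_real \<mu> * g v)"
  proof
    assume "inj (\<lambda>g v. ?T g v - of_real \<mu> * g v)"
    from injD[OF this, of "\<lambda>v. of_real (x0 v)" "\<lambda>_. 0"] show False
      using x0(1) by (simp add: ev zero fun_eq_iff)
  qed
  then have "of_real \<mu> \<in> op_spectrum ?T"
    by (simp add: op_spectrum_def bij_def)
  then show "\<mu> \<in> Re ` op_spectrum ?T"
    by (metis Re_complex_of_real imageI)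
  fix r assume "r \<in> Re ` op_spectrum ?T"
  then obtain z where z: "z \<in> op_spectrum ?T" "r = Re z" by auto
  obtain g where g: "g \<noteq> (\<lambda>_. 0)" "\<And>v. ?T g v = z * g v"
    by (rule op_spectrum_eigenvector[OF _ _ z(1)])
      (simp_all add: discrete_laplacian_eq vertex_op_add vertex_op_scaleR scaleR_add_right)
  have gv: "vertex_op G \<alpha> g v = (weighted_degree G v / 2) *\<^sub>R (z * g v)" for v
    using d[of v] by (simp add: discrete_laplacian_eq flip: g(2))
  let ?m = "\<lambda>v. weighted_degree G v / 2"
  define N where "N = (\<Sum>v\<in>UNIV. ?m v * (cmod (g v))\<^sup>2)"
  obtain v where "g v \<noteq> 0" using g(1) by auto
  then have "0 < N"
    unfolding N_def using d by (intro sum_pos2[where i=v]) (auto simp: less_imp_le)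
  have "\<mu> * N = \<mu> * (\<Sum>v\<in>UNIV. ?m v * (Re (g v))\<^sup>2) + \<mu> * (\<Sum>v\<in>UNIV. ?m v * (Im (g v))\<^sup>2)"
    by (simp add: N_def cmod_power2 distrib_left sum.distrib)
  also have "\<dots> \<le> (\<Sum>v\<in>UNIV. Re (g v) * vertex_op G \<alpha> (\<lambda>v. Re (g v)) v)
      + (\<Sum>v\<in>UNIV. Im (g v) * vertex_op G \<alpha> (\<lambda>v. Im (g v)) v)"
    by (intro add_mono min)
  \<comment> \<open>Pointwise, Re g Re(z g) + Im g Im(z g) = Re z |g|^2, so realness of
    \<open>z\<close> is not presupposed.\<close>
  also have "\<dots> = Re z * N"
    by (simp add: vertex_op_linear bounded_linear.linear bounded_linear_Re bounded_linear_Im gv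
        N_def cmod_power2 sum_distrib_left flip: sum.distrib) (simp add: algebra_simps power2_eq_square add_divide_distrib diff_divide_distrib)
  finally show "\<mu> \<le> r"
    using \<open>0 < N\<close> z(2) by simp
qed

section \<open>Assembling both directions of the equivalence\<close>

theorem theorem5p3:
  fixes G :: "('v::finite, 'e::finite) metric_graph"
    and \<alpha> :: "'v \<Rightarrow> real"
  assumes "\<And>e. 0 < len G e"
    and "path_connected_space (mg_topology G)"
  shows "(\<exists>u. is_torsion_function G \<alpha> u \<and> strictly_positive G u) \<longleftrightarrow>
         0 < Inf (Re ` op_spectrum (discrete_laplacian G \<alpha>))"
proof -
  note l = assms(1)
  have d: "0 < weighted_degree G v" for v
    using weighted_degree_pos[OF assms] .
  define m where "m v = weighted_degree G v / 2" for v
  have m: "0 < m v" for v using d by (simp add: m_def)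
  obtain \<mu> x0 where x0: "x0 \<noteq> (\<lambda>_. 0)" "\<And>v. vertex_op G \<alpha> x0 v = \<mu> * m v * x0 v"
    and min: "\<And>x :: 'v \<Rightarrow> real. \<mu> * (\<Sum>v\<in>UNIV. m v * (x v)\<^sup>2) \<le> (\<Sum>v\<in>UNIV. x v * vertex_op G \<alpha> x v)"
    by (rule ground_state[of m G \<alpha>, OF m]) (rule that)
  have inf: "Inf (Re ` op_spectrum (discrete_laplacian G \<alpha>)) = \<mu>"
    using Inf_op_spectrum[OF d x0[unfolded m_def] min[unfolded m_def]] .
  have lin: "linear Re" "linear Im" "linear complex_of_real"
    by (simp_all add: bounded_linear.linear bounded_linear_Re bounded_linear_Im bounded_linear_of_real)
  show ?thesis
    unfolding inf
  proof
    assume "\<exists>u. is_torsion_function G \<alpha> u \<and> strictly_positive G u"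
    then obtain u where u: "laplacian_eq G \<alpha> u (\<lambda>e x. 1)" "strictly_positive G u"
      by (auto simp: is_torsion_function_def)
    then obtain U where U: "\<And>e x. x \<in> {0..len G e} \<Longrightarrow> u e x = edge_parabola (len G e) (U (src G e)) (U (tgt G e)) x"
      "\<And>v. vertex_op G \<alpha> U v = of_real (m v)"
      unfolding laplacian_eq_one_iff[OF l] m_def by blast
    have "0 < Re (U v)" for v
    proof -
      \<comment> \<open>Strict positivity speaks of points on edges, so it reaches a vertex value
        only through an edge ending there.\<close>
      have "incident G v \<noteq> {}" using d[of v] by (auto simp: weighted_degree_def)
      then obtain e b where "endpt G e b = v" by (auto simp: incident_def)
      moreover have "endpos G e b \<in> {0..len G e}"
        using l[of e] by (simp add: endpos_def)
      moreover have "u e (endpos G e b) = U (endpt G e b)"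
        using l[of e] by (simp add: U endpos_def endpt_def)
      ultimately show ?thesis using u(2) by (metis strictly_positive_def)
    qed
    moreover have "vertex_op G \<alpha> (\<lambda>v. Re (U v)) v = m v" for v
      by (simp add: vertex_op_linear lin U)
    ultimately show "0 < \<mu>"
      by (rule eigenvalue_pos[OF l m _ _ x0])
  next
    assume \<mu>: "0 < \<mu>"
    have pos: "0 < (\<Sum>v\<in>UNIV. x v * vertex_op G \<alpha> x v)" if x: "x \<noteq> (\<lambda>_. 0)" for x :: "'v \<Rightarrow> real"
    proof -
      obtain v where "x v \<noteq> 0" using x by auto
      then have "0 < (\<Sum>v\<in>UNIV. m v * (x v)\<^sup>2)"
        using m by (intro sum_pos2[where i=v]) (auto simp: less_imp_le)
      then have "0 < \<mu> * (\<Sum>v\<in>UNIV. m v * (x v)\<^sup>2)" using \<mu> by simp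
      then show ?thesis using min[of x] by linarith
    qed
    \<comment> \<open>A positive definite form has trivial kernel; this yields both existence and
      uniqueness of the vertex values.\<close>
    have ker: "x = (\<lambda>_. 0)" if "\<And>v. vertex_op G \<alpha> x v = 0" for x :: "'v \<Rightarrow> real"
      using pos[of x] that by fastforce
    have "inj (vertex_op G \<alpha> :: ('v \<Rightarrow> real) \<Rightarrow> _)"
    proof (rule injI)
      fix x y :: "'v \<Rightarrow> real" assume "vertex_op G \<alpha> x = vertex_op G \<alpha> y"
      then have "(\<lambda>v. x v - y v) = (\<lambda>_. 0)"
        by (intro ker) (simp add: vertex_op_diff)
      then show "x = y" by (simp add: fun_eq_iff)
    qed
    then have "surj (vertex_op G \<alpha> :: ('v \<Rightarrow> real) \<Rightarrow> _)"
      by (intro inj_imp_surj_fun vertex_op_add vertex_op_scaleR)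
    then obtain U where U: "vertex_op G \<alpha> U = m" by (metis surjD)
    have Upos: "0 < U v" for v
      using minimum_principle[OF l pos m, of U] U by simp
    define V where "V v = complex_of_real (U v)" for v
    have V: "vertex_op G \<alpha> V v = of_real (m v)" for v
      unfolding V_def by (simp add: vertex_op_linear lin U)
    define u where "u e = edge_parabola (len G e) (V (src G e)) (V (tgt G e))" for e
    have "laplacian_eq G \<alpha> u (\<lambda>e x. 1)"
      unfolding laplacian_eq_one_iff[OF l] using V by (auto simp: u_def m_def intro!: exI[of _ V])
    moreover have "u' e x = u e x"
      if u': "laplacian_eq G \<alpha> u' (\<lambda>e x. 1)" and x: "x \<in> {0..len G e}" for u' e x
    proof -
      obtain W where W: "\<And>e x. x \<in> {0..len G e} \<Longrightarrow> u' e x = edge_parabola (len G e) (W (src G e)) (W (tgt G e)) x"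
        "\<And>v. vertex_op G \<alpha> W v = of_real (m v)"
        using u' unfolding laplacian_eq_one_iff[OF l] m_def by blast
      have 0: "vertex_op G \<alpha> (\<lambda>v. W v - V v) v = 0" for v
        by (simp add: vertex_op_diff V W)
      \<comment> \<open>Competing solutions may be complex, while \<open>ker\<close> is about real
        functions; it is applied to the real and imaginary parts of the difference.\<close>
      have "(\<lambda>v. f (W v - V v)) = (\<lambda>_. 0)" if "linear f" for f :: "complex \<Rightarrow> real"
        by (rule ker) (simp only: vertex_op_linear[OF that] 0 linear_0[OF that])
      from this[OF lin(1)] this[OF lin(2)]
      have "W = V" by (simp add: fun_eq_iff complex_eq_iff)
      then show ?thesis using W(1)[OF x] by (simp add: u_def)
    qed
    ultimately have "is_torsion_function G \<alpha> u"
      by (simp add: is_torsion_function_def)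
    moreover have "strictly_positive G u"
      unfolding strictly_positive_def
    proof (intro allI ballI)
      fix e x assume x: "x \<in> {0..len G e}"
      let ?l = "len G e" and ?a = "U (src G e)" and ?b = "U (tgt G e)"
      have ue: "u e x = of_real (?a + x / ?l * (?b - ?a) + x * (?l - x) / 2)"
        by (simp add: u_def V_def edge_parabola_def)
      \<comment> \<open>A convex combination of two positive end values. Positivity must come from
        here, as the quadratic term vanishes at the ends.\<close>
      have "?a + x / ?l * (?b - ?a) = (1 - x / ?l) * ?a + x / ?l * ?b"
        by (simp add: algebra_simps)
      also have "\<dots> > 0"
      proof (cases "x = 0")
        case False
        then have "0 < x / ?l * ?b" using x l[of e] Upos by simp
        moreover have "0 \<le> (1 - x / ?l) * ?a" using x l[of e] Upos[of "src G e"] by simp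
        ultimately show ?thesis by linarith
      qed (simp add: Upos)
      finally have "0 < ?a + x / ?l * (?b - ?a)" .
      moreover have "0 \<le> x * (?l - x) / 2" using x by simp
      ultimately have "0 < ?a + x / ?l * (?b - ?a) + x * (?l - x) / 2" by linarith
      then show "u e x \<in> \<real> \<and> 0 < Re (u e x)"
        unfolding ue Re_complex_of_real by (simp only: Reals_of_real simp_thms)
    qed
    ultimately show "\<exists>u. is_torsion_function G \<alpha> u \<and> strictly_positive G u" by blast
  qed
qed

end
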